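(* Let $G$ be a $k$-connected graph and let $\mathfrak S\subset\mathfrak R_k(G)$ be a set of pairwise independent $k$-vertex cutsets. Then: (1) $T(G,\mathfrak S)$ is a tree. (2) For every $S\in\mathfrak S$ we have $d_{T(G,\mathfrak S)}(S)=|\mathrm{Part}(G;\{S\})|$. Moreover, for each part $A\in\mathrm{Part}(G;\{S\})$ there is a unique part $B\in\mathrm{Part}(G;\mathfrak S)$ such that $B\subset A$ and $B$ is adjacent to $S$ in $T(G,\mathfrak S)$. Every leaf of $T(G,\mathfrak S)$ corresponds to a part of $\mathrm{Part}(G;\mathfrak S)$. (3) Let $S\in\mathfrak S$ and $B,B'\in\mathrm{Part}(G;\mathfrak S)$. Then $S$ separates $B$ from $B'$ in the graph $G$ if and only if $S$ separates $B$ from $B'$ in the tree $T(G,\mathfrak S)$ (i.e. $B$ and $B'$ lie in different connected components of $T(G,\mathfrak S)-S$).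
   Context: All graphs are finite, undirected, without loops or multiple edges. For $R\subset V(G)$, $G-R$ is the graph obtained by deleting the vertices of $R$ and their incident edges. A connected component means the vertex set of a maximal connected subgraph. A set $R\subset V(G)$ is a cutset if $G-R$ is disconnected; $\mathfrak R(G)$ denotes the set of all cutsets and $\mathfrak R_k(G)$ the set of cutsets with exactly $k$ vertices. For $X,Y\subset V(G)$ with $X\not\subset R$, $Y\not\subset R$, the set $R$ separates $X$ from $Y$ if no vertex of $X\setminus R$ and no vertex of $Y\setminus R$ lie in a common connected component of $G-R$. $R$ splits $X\subset V(G)$ if $X\setminus R$ is not contained in one connected component of $G-R$. $G$ is $k$-connected if $v(G)>k$ and $G$ has no cutset with at most $k-1$ vertices. Two cutsets $S,T\in\mathfrak R_k(G)$ of a $k$-connected graph are independent if $S$ does not split $T$ and $T$ does not split $S$. For $\mathfrak S\subset\mathfrak R(G)$, a set $A\subset V(G)$ is a part of the $\mathfrak S$-decomposition if no cutset of $\mathfrak S$ splits $A$, but every vertex $b\in V(G)\setminus A$ is separated from $A$ by some cutset of $\mathfrak S$; $\mathrm{Part}(G;\mathfrak S)$ denotes the set of all such parts. The tree of decomposition $T(G,\mathfrak S)$ is the bipartite graph whose vertices on one side are the cutsets $S\in\mathfrak S$ and on the other side the parts $A\in\mathrm{Part}(G;\mathfrak S)$, with $S$ adjacent to $A$ if and only if $S\subset A$. *)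

theory Defs
  imports "Graph_Theory.Graph_Theory"
begin

text \<open>
  Finite simple undirected graphs are symmetric digraphs (locale \<open>graph\<close>): every undirected edge
  is a pair of opposite arcs, so \<open>out_degree\<close> is the usual degree.
\<close>

text \<open>
  \<open>connected\<close> ignores arc orientation, so although \<open>max_subgraph\<close> ranges over arbitrary
  subdigraphs, the maximal connected ones of a symmetric digraph are the usual connected components.
\<close>
definition components :: "('a, 'b) pre_digraph \<Rightarrow> 'a set set" where
  "components G = verts ` {H. pre_digraph.max_subgraph G Digraph_Component.connected H}"

definition delete_verts :: "('a, 'b) pre_digraph \<Rightarrow> 'a set \<Rightarrow> ('a, 'b) pre_digraph" where
  "delete_verts G R = G \<restriction> (verts G - R)"

text \<open>
  In the library the empty graph is not \<open>connected\<close>; here it must not count as disconnected either,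
  so the whole vertex set is never a cutset.
\<close>
definition cutset :: "('a, 'b) pre_digraph \<Rightarrow> 'a set \<Rightarrow> bool" where
  "cutset G R \<longleftrightarrow> R \<subset> verts G \<and> \<not> Digraph_Component.connected (delete_verts G R)"

definition k_cutsets :: "('a, 'b) pre_digraph \<Rightarrow> nat \<Rightarrow> 'a set set" where
  "k_cutsets G k = {R. cutset G R \<and> card R = k}"

definition k_connected :: "('a, 'b) pre_digraph \<Rightarrow> nat \<Rightarrow> bool" where
  "k_connected G k \<longleftrightarrow> k < card (verts G) \<and> \<not> (\<exists>R. cutset G R \<and> card R < k)"

text \<open>
  Separation is meant only for sets not contained in \<open>R\<close>; the relation is false otherwise. In
  particular, a vertex of \<open>R\<close> is not separated from anything by \<open>R\<close>.
\<close>
definition separates :: "('a, 'b) pre_digraph \<Rightarrow> 'a set \<Rightarrow> 'a set \<Rightarrow> 'a set \<Rightarrow> bool" where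
  "separates G R X Y \<longleftrightarrow> \<not> X \<subseteq> R \<and> \<not> Y \<subseteq> R \<and>
     (\<forall>x \<in> X - R. \<forall>y \<in> Y - R. \<not> (\<exists>C \<in> components (delete_verts G R). x \<in> C \<and> y \<in> C))"

definition splits :: "('a, 'b) pre_digraph \<Rightarrow> 'a set \<Rightarrow> 'a set \<Rightarrow> bool" where
  "splits G R X \<longleftrightarrow> \<not> (\<exists>C \<in> components (delete_verts G R). X - R \<subseteq> C)"

definition independent_cutsets :: "('a, 'b) pre_digraph \<Rightarrow> 'a set \<Rightarrow> 'a set \<Rightarrow> bool" where
  "independent_cutsets G S T \<longleftrightarrow> \<not> splits G S T \<and> \<not> splits G T S"

definition parts :: "('a, 'b) pre_digraph \<Rightarrow> 'a set set \<Rightarrow> 'a set set" where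
  "parts G \<SS> = {A. A \<subseteq> verts G \<and> (\<forall>S \<in> \<SS>. \<not> splits G S A) \<and>
     (\<forall>b \<in> verts G - A. \<exists>S \<in> \<SS>. separates G S {b} A)}"

text \<open>\<open>Inl\<close> tags the cutsets and \<open>Inr\<close> the parts, making the two sides disjoint.\<close>
definition decomposition_tree ::
    "('a, 'b) pre_digraph \<Rightarrow> 'a set set \<Rightarrow> ('a set + 'a set) pair_pre_digraph" where
  "decomposition_tree G \<SS> =
     \<lparr> pverts = Inl ` \<SS> \<union> Inr ` parts G \<SS>,
       parcs = (\<Union>S \<in> \<SS>. \<Union>A \<in> {A \<in> parts G \<SS>. S \<subseteq> A}. {(Inl S, Inr A), (Inr A, Inl S)}) \<rparr>"

text \<open>
  The library's \<open>tree\<close> forbids every directed cycle, hence also an arc followed by its reverse, and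
  so fails for every symmetric digraph with an edge. The undirected cycles of a simple graph are
  exactly the directed cycles of length at least 3 (both orientations).
\<close>
definition undirected_tree :: "('a, 'b) pre_digraph \<Rightarrow> bool" where
  "undirected_tree G \<longleftrightarrow> graph G \<and> Digraph_Component.connected G \<and>
     \<not> (\<exists>p. pre_digraph.cycle G p \<and> 3 \<le> length p)"

definition leaf :: "('a, 'b) pre_digraph \<Rightarrow> 'a \<Rightarrow> bool" where
  "leaf G x \<longleftrightarrow> x \<in> verts G \<and> out_degree G x = 1"

end

(* A cutset S, together with a set X that no cutset of the family splits, determines the component
   of G - S containing X - S: the side of X.  By k-connectivity every vertex of S has neighbours in
   all components of G - S; so if W separates a vertex of U from X, the side of X at W is strictly
   smaller than its side at U.  This descent shows that for each component C of G - S the vertices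
   of S Un C not separated from S form a part strictly larger than S, the only part between S and
   S Un C.  It also shows that among the cutsets separating two parts B and B', one with the
   smallest side of B lies inside B; walking through it leads to a part separated from B' by fewer
   cutsets, whence the tree is connected.  Along walks of the tree avoiding S the side at S does not
   change, so distinct neighbours of S stay apart in the tree minus S: there are no cycles, and
   separation in the tree agrees with separation in G. *)

theory Submission
  imports Defs
begin

section \<open>Components of symmetric digraphs\<close>

lemma (in sym_digraph) connected_iff_reachable:
  "Digraph_Component.connected G \<longleftrightarrow>
     verts G \<noteq> {} \<and> (\<forall>u \<in> verts G. \<forall>v \<in> verts G. u \<rightarrow>\<^sup>* v)"
  by (simp add: connected_def strongly_connected_def reachable_mk_symmetric_eq[OF sym_arcs])

lemma (in sym_digraph) connected_subgraph_reachable: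
  assumes "subgraph H G" "Digraph_Component.connected H" "x \<in> verts H" "y \<in> verts H"
  shows "x \<rightarrow>\<^sup>* y"
proof -
  have "x \<rightarrow>\<^sup>*\<^bsub>mk_symmetric H\<^esub> y"
    using assms by (simp add: connected_def strongly_connected_def)
  then have "x \<rightarrow>\<^sup>*\<^bsub>mk_symmetric G\<^esub> y"
    using pre_digraph.reachable_mono[OF _ subgraph_mk_symmetric[OF assms(1)]] by blast
  then show ?thesis
    by (simp add: reachable_mk_symmetric_eq[OF sym_arcs])
qed

lemma (in sym_digraph) connected_induce_reachable:
  assumes "x \<in> verts G"
  shows "Digraph_Component.connected (G \<restriction> {y. x \<rightarrow>\<^sup>* y})"
proof -
  let ?K = "G \<restriction> {y. x \<rightarrow>\<^sup>* y}"
  have ind: "induced_subgraph ?K G"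
    by (rule induced_induce) (auto dest: reachable_in_verts)
  interpret K: sym_digraph ?K
    by (rule induced_graph_imp_graph[OF ind])
  have "u \<rightarrow>\<^sup>*\<^bsub>?K\<^esub> v" if "x \<rightarrow>\<^sup>* u" "x \<rightarrow>\<^sup>* v" for u v
    using that[THEN induce_reachable_preserves_paths] K.symmetric_reachable' K.reachable_trans
    by blast
  then show ?thesis
    unfolding K.connected_iff_reachable using assms by auto
qed

text \<open>Replaces maximal subgraphs by reachability classes. A connected subgraph through
  \<open>x\<close> lies in the subgraph induced on the class of \<open>x\<close>, which is itself
  connected, so the maximal ones are exactly these induced subgraphs.\<close>

lemma (in sym_digraph) components_eq: "components G = (\<lambda>x. {y. x \<rightarrow>\<^sup>* y}) ` verts G"
proof (intro set_eqI iffI)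
  fix C assume "C \<in> components G"
  then obtain H where C: "C = verts H" and max: "max_subgraph Digraph_Component.connected H"
    by (auto simp: components_def)
  have H: "subgraph H G" "Digraph_Component.connected H"
    using max by (auto simp: max_subgraph_def)
  then obtain x where x: "x \<in> verts H"
    by (auto simp: connected_def strongly_connected_def)
  with H have xG: "x \<in> verts G"
    by (auto dest: subgraph_imp_subverts)
  let ?K = "G \<restriction> {y. x \<rightarrow>\<^sup>* y}"
  have sub: "verts H \<subseteq> {y. x \<rightarrow>\<^sup>* y}"
    using connected_subgraph_reachable[OF H x] by auto
  have KG: "subgraph ?K G"
    by (rule subgraph_induce_subgraphI) (auto dest: reachable_in_verts)
  have "subgraph H ?K"
    using H(1) sub wf_digraph.tail_in_verts[of H] wf_digraph.head_in_verts[of H]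
    by (auto simp: subgraph_def compatible_def)
  then have "?K = H"
    using max KG connected_induce_reachable[OF xG] unfolding max_subgraph_def by blast
  then have "verts H = {y. x \<rightarrow>\<^sup>* y}"
    using induce_subgraph_verts by metis
  then show "C \<in> (\<lambda>x. {y. x \<rightarrow>\<^sup>* y}) ` verts G"
    using C xG by auto
next
  fix C assume "C \<in> (\<lambda>x. {y. x \<rightarrow>\<^sup>* y}) ` verts G"
  then obtain x where x: "x \<in> verts G" and C: "C = {y. x \<rightarrow>\<^sup>* y}"
    by auto
  let ?K = "G \<restriction> C"
  have ind: "induced_subgraph ?K G"
    unfolding C by (rule induced_induce) (auto dest: reachable_in_verts)
  have "H = ?K"
    if "subgraph ?K H" "subgraph H G" "Digraph_Component.connected H" for H
  proof -
    have vH: "verts H = C"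
    proof
      show "C \<subseteq> verts H"
        using subgraph_imp_subverts[OF that(1)] by simp
      moreover have "x \<in> C" using x C by auto
      ultimately show "verts H \<subseteq> C"
        using connected_subgraph_reachable[OF that(2,3)] unfolding C by auto
    qed
    have "arcs H = arcs ?K"
    proof
      show "arcs ?K \<subseteq> arcs H" using that(1) by (simp add: subgraph_def)
      interpret H: wf_digraph H using that(1) by auto
      have "tail H = tail G" "head H = head G"
        using that(2) by (auto simp: compatible_def)
      then show "arcs H \<subseteq> arcs ?K"
        using that(2) vH H.tail_in_verts H.head_in_verts by auto
    qed
    moreover have "tail H = tail ?K" "head H = head ?K"
      using that(2) by (auto simp: compatible_def)
    ultimately show ?thesis
      using vH by (auto intro!: pre_digraph.equality)
  qed
  then have "max_subgraph Digraph_Component.connected ?K"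
    unfolding max_subgraph_def
    using connected_induce_reachable[OF x] ind C by (auto dest: induced_imp_subgraph)
  moreover have "C = verts ?K" by simp
  ultimately show "C \<in> components G"
    unfolding components_def by blast
qed

section \<open>Vertex deletion and the components of what remains\<close>

lemma separatesI:
  assumes "\<not> X \<subseteq> R" "\<not> Y \<subseteq> R"
    and "\<And>x y. x \<in> X - R \<Longrightarrow> y \<in> Y - R \<Longrightarrow>
           \<not> (\<exists>C \<in> components (delete_verts G R). x \<in> C \<and> y \<in> C)"
  shows "separates G R X Y"
  unfolding separates_def by (intro conjI ballI assms)

lemma separatesD:
  assumes "separates G R X Y" "x \<in> X - R" "y \<in> Y - R"
  shows "\<not> (\<exists>C \<in> components (delete_verts G R). x \<in> C \<and> y \<in> C)"
  using assms unfolding separates_def by blast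

lemma (in graph) graph_delete_verts: "graph (delete_verts G R)"
proof -
  have ind: "induced_subgraph (delete_verts G R) G"
    unfolding delete_verts_def by (rule induced_induce) auto
  show ?thesis
    using digraph.graphI[OF digraphI_induced[OF ind]] induced_graph_imp_symmetric[OF sym_arcs ind]
    by blast
qed

lemma verts_delete_verts [simp]: "verts (delete_verts G R) = verts G - R"
  by (simp add: delete_verts_def)

lemma dominates_delete_verts_iff:
  "u \<rightarrow>\<^bsub>delete_verts G R\<^esub> v \<longleftrightarrow>
     u \<rightarrow>\<^bsub>G\<^esub> v \<and> u \<in> verts G - R \<and> v \<in> verts G - R"
  by (auto simp: delete_verts_def arcs_ends_conv)

context graph
begin

abbreviation comps :: "'a set \<Rightarrow> 'a set set" where
  "comps R \<equiv> components (delete_verts G R)"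

lemma dominates_sym: "u \<rightarrow> v \<Longrightarrow> v \<rightarrow> u"
  by (rule graph_symmetric)

lemma comps_eq: "comps R = (\<lambda>x. {y. x \<rightarrow>\<^sup>*\<^bsub>delete_verts G R\<^esub> y}) ` (verts G - R)"
proof -
  interpret D: graph "delete_verts G R" by (rule graph_delete_verts)
  show ?thesis using D.components_eq by simp
qed

text \<open>Reachability relates only vertices of the digraph, so membership hypotheses are built
  in: for \<open>x\<close> in \<open>R\<close> or outside \<open>G\<close> both sides are
  false.\<close>

lemma comps_same_iff:
  "(\<exists>C \<in> comps R. x \<in> C \<and> y \<in> C) \<longleftrightarrow> x \<rightarrow>\<^sup>*\<^bsub>delete_verts G R\<^esub> y"
proof -
  interpret D: graph "delete_verts G R" by (rule graph_delete_verts)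
  have "x \<rightarrow>\<^sup>*\<^bsub>delete_verts G R\<^esub> y \<Longrightarrow> x \<in> verts G - R"
    using D.reachable_in_verts by auto
  then show ?thesis
    unfolding comps_eq
    by (auto intro: D.reachable_trans D.symmetric_reachable' bexI[of _ x])
qed

lemma comps_subset: "C \<in> comps R \<Longrightarrow> C \<subseteq> verts G - R"
proof -
  interpret D: graph "delete_verts G R" by (rule graph_delete_verts)
  show "C \<in> comps R \<Longrightarrow> C \<subseteq> verts G - R"
    unfolding comps_eq using D.reachable_in_verts by auto
qed

lemma comps_cover: "x \<in> verts G - R \<Longrightarrow> \<exists>C \<in> comps R. x \<in> C"
proof -
  interpret D: graph "delete_verts G R" by (rule graph_delete_verts)
  show "x \<in> verts G - R \<Longrightarrow> \<exists>C \<in> comps R. x \<in> C"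
    unfolding comps_eq using D.reachable_refl by fastforce
qed

lemma comps_nonempty: "C \<in> comps R \<Longrightarrow> C \<noteq> {}"
proof -
  interpret D: graph "delete_verts G R" by (rule graph_delete_verts)
  show "C \<in> comps R \<Longrightarrow> C \<noteq> {}"
    unfolding comps_eq using D.reachable_refl by fastforce
qed

lemma comps_unique:
  assumes "C \<in> comps R" "D \<in> comps R" "x \<in> C" "x \<in> D"
  shows "C = D"
proof -
  interpret D: graph "delete_verts G R" by (rule graph_delete_verts)
  show ?thesis
    using assms unfolding comps_eq
    by (auto; meson D.reachable_trans D.symmetric_reachable')
qed

lemma comps_closed:
  assumes "C \<in> comps R" "x \<in> C" "x \<rightarrow> y" "y \<notin> R"
  shows "y \<in> C"
proof -
  interpret D: graph "delete_verts G R" by (rule graph_delete_verts)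
  have "x \<in> verts G - R" using comps_subset assms by blast
  then have "x \<rightarrow>\<^bsub>delete_verts G R\<^esub> y"
    using assms adj_in_verts by (auto simp: dominates_delete_verts_iff)
  then show ?thesis
    using assms(1,2) unfolding comps_eq by (auto intro: D.reachable_adj_trans)
qed

lemma closed_reachable:
  assumes "x \<rightarrow>\<^sup>*\<^bsub>delete_verts G R\<^esub> y" "x \<in> X"
    and closed: "\<And>u v. u \<in> X \<Longrightarrow> u \<rightarrow> v \<Longrightarrow> v \<notin> R \<Longrightarrow> v \<in> X"
  shows "y \<in> X"
proof -
  interpret D: graph "delete_verts G R" by (rule graph_delete_verts)
  from assms(1) show ?thesis
    by (induction rule: D.reachable_induct)
       (use assms(2) closed in \<open>auto simp: dominates_delete_verts_iff\<close>)
qed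

lemma comps_disjoint_subset:
  assumes C: "C \<in> comps S" and disj: "C \<inter> T = {}"
  obtains D where "D \<in> comps T" "C \<subseteq> D"
proof -
  interpret D: graph "delete_verts G S" by (rule graph_delete_verts)
  obtain x where x: "x \<in> verts G - S" and Cx: "C = {y. x \<rightarrow>\<^sup>*\<^bsub>delete_verts G S\<^esub> y}"
    using C unfolding comps_eq by auto
  then have "x \<in> C" by auto
  with disj x obtain D where D: "D \<in> comps T" "x \<in> D"
    using comps_cover[of x T] by auto
  have "y \<in> D" if "x \<rightarrow>\<^sup>*\<^bsub>delete_verts G S\<^esub> y" for y
    using that
  proof (induction rule: D.reachable_induct)
    case base
    show ?case by (rule D(2))
  next
    case (step u v)
    then have "x \<rightarrow>\<^sup>*\<^bsub>delete_verts G S\<^esub> v"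
      by (auto intro: D.reachable_adj_trans)
    then have "v \<in> C" by (simp add: Cx)
    then have "v \<notin> T" using disj by auto
    then show ?case
      using step comps_closed[OF D(1)] by (auto simp: dominates_delete_verts_iff)
  qed
  then have "C \<subseteq> D" by (auto simp: Cx)
  with D(1) show ?thesis by (rule that)
qed

lemma comps_two:
  assumes "cutset G S" "C \<in> comps S"
  obtains D where "D \<in> comps S" "D \<noteq> C"
proof -
  interpret D: graph "delete_verts G S" by (rule graph_delete_verts)
  have "verts G - S \<noteq> {}" "\<not> Digraph_Component.connected (delete_verts G S)"
    using assms(1) by (auto simp: cutset_def)
  then obtain u v where uv: "u \<in> verts G - S" "v \<in> verts G - S"
      "\<not> u \<rightarrow>\<^sup>*\<^bsub>delete_verts G S\<^esub> v"
    unfolding D.connected_iff_reachable by auto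
  then obtain D E where "D \<in> comps S" "u \<in> D" "E \<in> comps S" "v \<in> E"
    using comps_cover by meson
  moreover from this have "D \<noteq> E"
    using uv(3) comps_same_iff by blast
  ultimately show ?thesis using that by metis
qed

text \<open>By \<open>k\<close>-connectivity the neighbourhood of a component of \<open>G - S\<close> cannot be a smaller cutset
  than \<open>S\<close>.\<close>
lemma comps_neighbour:
  assumes "k_connected G k" "S \<in> k_cutsets G k" "C \<in> comps S" "s \<in> S"
  obtains x where "x \<in> C" "s \<rightarrow> x"
proof (rule ccontr)
  assume no: "\<not> thesis"
  \<comment> \<open>\<open>N\<close> is the neighbourhood of \<open>C\<close>, which cuts
    \<open>C\<close> off from every other component. If \<open>s\<close> had no neighbour in
    \<open>C\<close>, it would be strictly smaller than \<open>S\<close>.\<close>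
  define N where "N = {t \<in> S. \<exists>x \<in> C. x \<rightarrow> t}"
  have S: "cutset G S" "card S = k" "S \<subset> verts G"
    using assms(2) by (auto simp: k_cutsets_def cutset_def)
  have "N \<subset> S"
    using no that assms(4) dominates_sym unfolding N_def by blast
  moreover have "finite S"
    using S(3) finite_verts finite_subset by blast
  ultimately have "card N < k"
    using S(2) psubset_card_mono by blast
  obtain D where D: "D \<in> comps S" "D \<noteq> C"
    using comps_two[OF S(1) assms(3)] .
  obtain c d where cd: "c \<in> C" "d \<in> D"
    using comps_nonempty assms(3) D(1) by blast
  have "d \<notin> C"
    using comps_unique assms(3) D cd(2) by blast
  have "v \<in> C" if "u \<in> C" "u \<rightarrow> v" "v \<notin> N" for u v
    using comps_closed[OF assms(3) that(1,2)] that unfolding N_def by blast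
  then have "\<not> c \<rightarrow>\<^sup>*\<^bsub>delete_verts G N\<^esub> d"
    using closed_reachable[of N c d C] cd(1) \<open>d \<notin> C\<close> by blast
  moreover have "c \<in> verts G - N" "d \<in> verts G - N"
    using cd assms(3) D(1) comps_subset \<open>N \<subset> S\<close> by blast+
  ultimately have "\<not> Digraph_Component.connected (delete_verts G N)"
    using sym_digraph.connected_iff_reachable[of "delete_verts G N"] graph_delete_verts[of N]
    by (auto simp: graph_def pseudo_graph_def)
  then have "cutset G N"
    unfolding cutset_def using \<open>N \<subset> S\<close> S(3) by auto
  with \<open>card N < k\<close> show False
    using assms(1) by (auto simp: k_connected_def)
qed

end

section \<open>Sides of a cutset\<close>

text \<open>The union keeps \<open>side\<close> total: it is the component containing
  \<open>X - S\<close> when \<open>X\<close> is neither split by \<open>S\<close> nor inside it, and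
  empty when \<open>X \<subseteq> S\<close>.\<close>

definition (in graph) side :: "'a set \<Rightarrow> 'a set \<Rightarrow> 'a set" where
  "side S X = \<Union>{C \<in> comps S. C \<inter> X \<noteq> {}}"

context graph
begin

lemma side_props:
  assumes "X \<subseteq> verts G" "\<not> splits G S X" "\<not> X \<subseteq> S"
  shows "side S X \<in> comps S" "X - S \<subseteq> side S X"
proof -
  obtain C where C: "C \<in> comps S" "X - S \<subseteq> C"
    using assms(2) by (auto simp: splits_def)
  have "D = C" if "D \<in> comps S" "D \<inter> X \<noteq> {}" for D
    using that C comps_subset comps_unique by blast
  moreover have "C \<inter> X \<noteq> {}" using C assms(3) by auto
  ultimately have "{D \<in> comps S. D \<inter> X \<noteq> {}} = {C}"
    using C(1) by blast
  then have "side S X = C" by (simp add: side_def)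
  with C show "side S X \<in> comps S" "X - S \<subseteq> side S X" by auto
qed

lemma side_eq:
  assumes "X \<subseteq> verts G" "\<not> splits G S X" "C \<in> comps S" "x \<in> X" "x \<in> C"
  shows "side S X = C"
proof -
  have "x \<notin> S" using assms(3,5) comps_subset by blast
  then have "side S X \<in> comps S" "x \<in> side S X"
    using side_props[OF assms(1,2)] assms(4) by blast+
  then show ?thesis
    using comps_unique assms(3,5) by blast
qed

lemma not_splits_subset: "\<not> splits G S Y \<Longrightarrow> X \<subseteq> Y \<Longrightarrow> \<not> splits G S X"
  unfolding splits_def by blast

lemma not_splits_singleton:
  assumes "cutset G S" "b \<in> verts G"
  shows "\<not> splits G S {b}"
proof (cases "b \<in> S")
  case True
  \<comment> \<open>\<open>{b} - S\<close> is empty here, but \<open>splits\<close> still asks for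
    some component containing it, so one has to exist.\<close>
  obtain c where "c \<in> verts G - S" using assms(1) by (auto simp: cutset_def)
  with comps_cover True show ?thesis by (fastforce simp: splits_def)
next
  case False
  with comps_cover[of b S] assms(2) show ?thesis by (auto simp: splits_def)
qed

text \<open>A vertex of \<open>X\<close> outside \<open>S\<close> already pins down the component
  holding \<open>Y - S\<close>. This moves sides between a part, its vertices and the cutsets inside
  it.\<close>

lemma side_mono:
  assumes "Y \<subseteq> verts G" "\<not> splits G S Y" "X \<subseteq> Y" "\<not> X \<subseteq> S"
  shows "side S X = side S Y"
proof -
  obtain x where "x \<in> X" "x \<notin> S" using assms(4) by blast
  moreover from this have "side S Y \<in> comps S" "x \<in> side S Y"
    using side_props[of Y S] assms by blast+
  ultimately show ?thesis
    using side_eq[of X S "side S Y" x] not_splits_subset assms(1-3) by blast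
qed

lemma separates_iff:
  assumes "X \<subseteq> verts G" "\<not> splits G S X" "Y \<subseteq> verts G" "\<not> splits G S Y"
  shows "separates G S X Y \<longleftrightarrow> \<not> X \<subseteq> S \<and> \<not> Y \<subseteq> S \<and> side S X \<noteq> side S Y"
proof (cases "X \<subseteq> S \<or> Y \<subseteq> S")
  case True
  then show ?thesis by (elim disjE) (simp_all add: separates_def)
next
  case False
  then have nX: "\<not> X \<subseteq> S" and nY: "\<not> Y \<subseteq> S" by simp_all
  note X = side_props[OF assms(1,2) nX] and Y = side_props[OF assms(3,4) nY]
  obtain x y where xy: "x \<in> X - S" "y \<in> Y - S" using False by blast
  have X': "D = side S X" if "D \<in> comps S" "z \<in> D" "z \<in> X - S" for D z
    using comps_unique[OF that(1) X(1) that(2) subsetD[OF X(2) that(3)]] .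
  have Y': "D = side S Y" if "D \<in> comps S" "z \<in> D" "z \<in> Y - S" for D z
    using comps_unique[OF that(1) Y(1) that(2) subsetD[OF Y(2) that(3)]] .
  show ?thesis
  proof
    assume sep: "separates G S X Y"
    have "side S X \<noteq> side S Y"
    proof
      assume "side S X = side S Y"
      then have "x \<in> side S X" "y \<in> side S X" using X(2) Y(2) xy by auto
      with X(1) have "\<exists>C \<in> comps S. x \<in> C \<and> y \<in> C" by blast
      then show False using separatesD[OF sep xy] by contradiction
    qed
    with False show "\<not> X \<subseteq> S \<and> \<not> Y \<subseteq> S \<and> side S X \<noteq> side S Y" by simp
  next
    assume ne: "\<not> X \<subseteq> S \<and> \<not> Y \<subseteq> S \<and> side S X \<noteq> side S Y"
    have "\<not> (\<exists>C \<in> comps S. x \<in> C \<and> y \<in> C)" if "x \<in> X - S" "y \<in> Y - S" for x y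
    proof
      assume "\<exists>C \<in> comps S. x \<in> C \<and> y \<in> C"
      then obtain D where D: "D \<in> comps S" "x \<in> D" "y \<in> D" by blast
      have "side S X = side S Y"
        using X'[OF D(1,2) that(1)] Y'[OF D(1,3) that(2)] by (rule subst)
      with ne show False by simp
    qed
    with nX nY show "separates G S X Y" by (rule separatesI)
  qed
qed

text \<open>A vertex of \<open>P\<close> outside \<open>B\<close> would be separated from
  \<open>B\<close> by a cutset of the family, but that cutset does not split \<open>P\<close>, which
  contains both.\<close>

lemma part_maximal:
  assumes "B \<in> parts G \<FF>" "B \<subseteq> P" "P \<subseteq> verts G" "\<And>S. S \<in> \<FF> \<Longrightarrow> \<not> splits G S P"
  shows "P = B"
proof (rule ccontr)
  assume "P \<noteq> B"
  then obtain b where b: "b \<in> P" "b \<notin> B" using assms(2) by blast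
  then obtain S where S: "S \<in> \<FF>" "separates G S {b} B"
    using assms(1,3) unfolding parts_def by blast
  then obtain C where "C \<in> comps S" "P - S \<subseteq> C"
    using assms(4) by (auto simp: splits_def)
  then show False
    using S b assms(2) unfolding separates_def by blast
qed

text \<open>Each set \<open>S \<union> C\<close> is not split by \<open>S\<close>, so a part inside
  it fills it by maximality.\<close>

lemma parts_singleton:
  assumes S: "cutset G S"
  shows "parts G {S} = (\<lambda>C. S \<union> C) ` comps S"
proof (intro set_eqI iffI)
  fix A assume "A \<in> (\<lambda>C. S \<union> C) ` comps S"
  then obtain C where C: "C \<in> comps S" "A = S \<union> C" by auto
  have "separates G S {b} A" if "b \<in> verts G" "b \<notin> A" for b
  proof -
    have "A - S \<subseteq> C" "\<not> A \<subseteq> S"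
      using C comps_nonempty[OF C(1)] comps_subset[OF C(1)] by auto
    moreover have "D = C" if "D \<in> comps S" "y \<in> D" "y \<in> C" for D y
      using comps_unique[OF that(1) C(1)] that by blast
    ultimately show ?thesis
      using that C(2) unfolding separates_def by fast
  qed
  then show "A \<in> parts G {S}"
    using C S comps_subset[OF C(1)] by (auto simp: parts_def splits_def cutset_def)
next
  fix A assume A: "A \<in> parts G {S}"
  then obtain C where C: "C \<in> comps S" "A - S \<subseteq> C"
    by (auto simp: parts_def splits_def)
  then have "S \<union> C = A"
    using S comps_subset[OF C(1)]
    by (intro part_maximal[OF A]) (auto simp: splits_def cutset_def)
  with C(1) show "A \<in> (\<lambda>C. S \<union> C) ` comps S" by blast
qed

end

section \<open>Families of independent cutsets\<close>

locale independent_cutset_family = graph G for G :: "('a, 'b) pre_digraph" +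
  fixes k :: nat and \<SS> :: "'a set set"
  assumes k_connected: "k_connected G k"
    and cutsets: "\<SS> \<subseteq> k_cutsets G k"
    and independent: "pairwise (independent_cutsets G) \<SS>"
begin

text \<open>The common property of parts, cutsets of the family and single vertices, so that the
  same facts on sides serve all three.\<close>

definition unsplit :: "'a set \<Rightarrow> bool" where
  "unsplit X \<longleftrightarrow> X \<subseteq> verts G \<and> (\<forall>S \<in> \<SS>. \<not> splits G S X)"

lemma cutset: "S \<in> \<SS> \<Longrightarrow> cutset G S"
  using cutsets by (auto simp: k_cutsets_def)

lemma cutset_subset: "S \<in> \<SS> \<Longrightarrow> S \<subset> verts G"
  using cutset by (auto simp: cutset_def)

lemma finite_cutset: "S \<in> \<SS> \<Longrightarrow> finite S"
  using cutset_subset finite_verts finite_subset by blast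

lemma finite_family: "finite \<SS>"
  using cutset_subset finite_subset[of \<SS> "Pow (verts G)"] by auto

lemma finite_side: "finite (side S X)"
proof -
  have "side S X \<subseteq> verts G"
    unfolding side_def using comps_subset by blast
  then show ?thesis using finite_verts finite_subset by blast
qed

text \<open>All members have \<open>k\<close> vertices. Hence no cutset lies inside another, and
  each has a genuine side at every other member.\<close>

lemma cutset_subset_eq:
  assumes "S \<in> \<SS>" "T \<in> \<SS>" "S \<subseteq> T"
  shows "S = T"
proof -
  have "card S = k" "card T = k" using assms cutsets by (auto simp: k_cutsets_def)
  then show ?thesis using card_subset_eq[OF finite_cutset[OF assms(2)] assms(3)] by simp
qed

lemma unsplit_singleton: "b \<in> verts G \<Longrightarrow> unsplit {b}"
  using not_splits_singleton cutset by (auto simp: unsplit_def)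

lemma unsplit_cutset:
  assumes "S \<in> \<SS>"
  shows "unsplit S"
proof -
  have "\<not> splits G T S" if "T \<in> \<SS>" for T
  proof (cases "T = S")
    case True
    obtain c where "c \<in> verts G - S" using cutset_subset[OF assms] by blast
    with comps_cover True show ?thesis by (fastforce simp: splits_def)
  next
    case False
    then show ?thesis
      using independent assms that by (auto simp: pairwise_def independent_cutsets_def)
  qed
  then show ?thesis
    using cutset_subset[OF assms] by (auto simp: unsplit_def)
qed

lemma unsplit_part: "B \<in> parts G \<SS> \<Longrightarrow> unsplit B"
  by (auto simp: unsplit_def parts_def)

lemma unsplit_side:
  assumes "unsplit X" "S \<in> \<SS>" "\<not> X \<subseteq> S"
  shows "side S X \<in> comps S" "X - S \<subseteq> side S X"
  using side_props assms by (auto simp: unsplit_def)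

lemma unsplit_side_eq:
  assumes "unsplit X" "S \<in> \<SS>" "C \<in> comps S" "x \<in> X" "x \<in> C"
  shows "side S X = C"
  using side_eq assms by (auto simp: unsplit_def)

lemma unsplit_side_mono:
  assumes "unsplit Y" "S \<in> \<SS>" "X \<subseteq> Y" "\<not> X \<subseteq> S"
  shows "side S X = side S Y"
  using side_mono assms by (auto simp: unsplit_def)

lemma unsplit_separates_iff:
  assumes "unsplit X" "unsplit Y" "S \<in> \<SS>"
  shows "separates G S X Y \<longleftrightarrow> \<not> X \<subseteq> S \<and> \<not> Y \<subseteq> S \<and> side S X \<noteq> side S Y"
  using separates_iff assms by (auto simp: unsplit_def)

lemma unsplit_part_eq:
  assumes "B \<in> parts G \<SS>" "B \<subseteq> P" "unsplit P"
  shows "P = B"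
  using part_maximal[OF assms(1,2)] assms(3) by (auto simp: unsplit_def)

lemma not_separates_subset:
  assumes "unsplit Y" "S \<in> \<SS>" "X \<subseteq> Y" "Z \<subseteq> Y"
  shows "\<not> separates G S X Z"
proof -
  obtain C where "C \<in> comps S" "Y - S \<subseteq> C"
    using assms by (auto simp: unsplit_def splits_def)
  then show ?thesis using assms(3,4) unfolding separates_def by blast
qed

text \<open>The engine of all minimality arguments: among the cutsets \<open>U\<close> with the side of \<open>X\<close> smallest,
  no vertex of \<open>U\<close> is separated from \<open>X\<close>.\<close>
lemma side_descent:
  assumes U: "U \<in> \<SS>" and W: "W \<in> \<SS>" and X: "unsplit X" "\<not> X \<subseteq> U"
    and u: "u \<in> U" "separates G W {u} X"
  shows "side W X \<subset> side U X"
proof -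
  have uV: "u \<in> verts G" using U u(1) cutset_subset by blast
  have sep: "u \<notin> W" "\<not> X \<subseteq> W" "side W {u} \<noteq> side W X"
    using u(2) unsplit_separates_iff[OF unsplit_singleton[OF uV] X(1) W] by auto
  \<comment> \<open>\<open>W\<close> does not split \<open>U\<close>, so all of \<open>U - W\<close>
    lies with \<open>u\<close>, in another component of \<open>G - W\<close> than
    \<open>X - W\<close>.\<close>
  have "side W {u} = side W U"
    using unsplit_side_mono[OF unsplit_cutset[OF U] W, of "{u}"] u(1) sep(1) by auto
  with sep(3) have ne: "side W U \<noteq> side W X" by simp
  have WU: "side W U \<in> comps W" "U - W \<subseteq> side W U"
    using unsplit_side[OF unsplit_cutset[OF U] W] u(1) sep(1) by auto
  have WX: "side W X \<in> comps W" "X - W \<subseteq> side W X"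
    using unsplit_side[OF X(1) W sep(2)] by auto
  have disj: "side W X \<inter> U = {}"
    using WU WX ne comps_unique comps_subset by blast
  then obtain D where D: "D \<in> comps U" "side W X \<subseteq> D"
    using comps_disjoint_subset[OF WX(1)] by blast
  obtain x where "x \<in> X" "x \<notin> W" using sep(2) by blast
  then have "side U X = D"
    using unsplit_side_eq[OF X(1) U D(1)] D(2) WX(2) by blast
  \<comment> \<open>A neighbour \<open>y\<close> of \<open>u\<close> in the side of \<open>X\<close>
    at \<open>U\<close> witnesses strictness: inside \<open>side W X\<close> it would pull in
    \<open>u\<close>, which is not in \<open>W\<close>, yet \<open>side W X\<close> avoids
    \<open>U\<close>.\<close>
  moreover obtain y where y: "y \<in> D" "u \<rightarrow>\<^bsub>G\<^esub> y"
    using comps_neighbour[OF k_connected _ D(1) u(1)] U cutsets by blast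
  moreover have "y \<notin> side W X"
    using comps_closed[OF WX(1) _ dominates_sym[OF y(2)] sep(1)] disj u(1) by blast
  ultimately show "side W X \<subset> side U X" using D(2) by blast
qed

section \<open>The part next to a cutset in a given component\<close>

text \<open>The candidate for the tree neighbour of \<open>S\<close> on the side \<open>C\<close>: a
  part containing \<open>S\<close> is unsplit, so none of its vertices is separated from
  \<open>S\<close>.\<close>

definition near_part :: "'a set \<Rightarrow> 'a set \<Rightarrow> 'a set" where
  "near_part S C = {x \<in> S \<union> C. \<forall>T \<in> \<SS>. \<not> separates G T {x} S}"

lemma cutset_subset_near_part: "S \<in> \<SS> \<Longrightarrow> S \<subseteq> near_part S C"
  using not_separates_subset[OF unsplit_cutset] by (auto simp: near_part_def)

text \<open>Otherwise every vertex of \<open>C\<close> is separated from \<open>S\<close>. Among the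
  cutsets doing this, one with the smallest side of \<open>S\<close> has a vertex in
  \<open>C\<close>; that vertex is separated from \<open>S\<close> as well, and
  \<open>side_descent\<close> gives a smaller side.\<close>

lemma near_part_not_subset:
  assumes S: "S \<in> \<SS>" and C: "C \<in> comps S"
  shows "\<not> near_part S C \<subseteq> S"
proof
  assume "near_part S C \<subseteq> S"
  then have all: "\<exists>T \<in> \<SS>. separates G T {x} S" if "x \<in> C" for x
    using that comps_subset[OF C] unfolding near_part_def by blast
  define \<FF> where "\<FF> = {T \<in> \<SS>. \<exists>x \<in> C. separates G T {x} S}"
  have "\<FF> \<noteq> {}" using all comps_nonempty[OF C] unfolding \<FF>_def by blast
  moreover have "finite \<FF>" using finite_family unfolding \<FF>_def by simp
  ultimately obtain T where T: "T \<in> \<FF>"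
      and min: "\<And>U. U \<in> \<FF> \<Longrightarrow> card (side T S) \<le> card (side U S)"
    using ex_min_if_finite[of "(\<lambda>T. card (side T S)) ` \<FF>"] by (auto simp: not_less)
  then obtain x where TS: "T \<in> \<SS>" and x: "x \<in> C" "separates G T {x} S"
    unfolding \<FF>_def by blast
  have uS: "unsplit S" and uT: "unsplit T" using S TS by (auto intro: unsplit_cutset)
  have xV: "x \<in> verts G" using x(1) comps_subset[OF C] by blast
  have ST: "\<not> S \<subseteq> T" and xT: "x \<notin> T" and ne: "side T {x} \<noteq> side T S"
    using x(2) unsplit_separates_iff[OF unsplit_singleton[OF xV] uS TS] by auto
  have TnS: "\<not> T \<subseteq> S" using cutset_subset_eq[OF TS S] ST by blast
  \<comment> \<open>If \<open>T\<close> missed \<open>C\<close>, all of \<open>C\<close> would lie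
    in one component of \<open>G - T\<close>, and an edge from a vertex of \<open>S - T\<close> into
    \<open>C\<close> would put \<open>S\<close> and \<open>x\<close> on the same side of
    \<open>T\<close>.\<close>
  have "C \<inter> T \<noteq> {}"
  proof
    assume "C \<inter> T = {}"
    then obtain D where D: "D \<in> comps T" "C \<subseteq> D"
      using comps_disjoint_subset[OF C] by blast
    obtain s where s: "s \<in> S" "s \<notin> T" using ST by blast
    then obtain y where y: "y \<in> C" "s \<rightarrow>\<^bsub>G\<^esub> y"
      using comps_neighbour[OF k_connected _ C] S cutsets by blast
    then have "s \<in> D"
      using comps_closed[OF D(1) _ dominates_sym[OF y(2)] s(2)] D(2) by blast
    then have "side T S = D" "side T {x} = D"
      using D(2) x(1) s(1) unsplit_side_eq[OF uS TS D(1)]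
        unsplit_side_eq[OF unsplit_singleton[OF xV] TS D(1)] by blast+
    with ne show False by simp
  qed
  then have "side S T = C"
    using unsplit_side_eq[OF uT S C] by blast
  then have "T - S \<subseteq> C" using unsplit_side[OF uT S TnS] by simp
  with TnS obtain t where t: "t \<in> T" "t \<in> C" by blast
  with all obtain U where U: "U \<in> \<SS>" "separates G U {t} S" by blast
  then have "side U S \<subset> side T S"
    using side_descent[OF TS _ uS ST t(1)] by blast
  then have "card (side U S) < card (side T S)"
    using psubset_card_mono[OF finite_side] by blast
  moreover have "U \<in> \<FF>" using U t(2) unfolding \<FF>_def by blast
  ultimately show False using min by fastforce
qed

text \<open>At a cutset \<open>U \<noteq> S\<close> the vertices outside \<open>U\<close> follow the
  side of \<open>S\<close>; at \<open>S\<close> itself the remaining ones lie in \<open>C\<close>. A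
  vertex left out is cut off by \<open>S\<close> if it lies outside \<open>S \<union> C\<close>, and
  otherwise by a cutset separating it from \<open>S\<close>.\<close>

lemma near_part_in_parts:
  assumes S: "S \<in> \<SS>" and C: "C \<in> comps S"
  shows "near_part S C \<in> parts G \<SS>"
proof -
  let ?P = "near_part S C"
  have PV: "?P \<subseteq> verts G"
    using cutset_subset[OF S] comps_subset[OF C] unfolding near_part_def by blast
  have uS: "unsplit S" using S by (rule unsplit_cutset)
  have sub: "?P - U \<subseteq> side U S" if U: "U \<in> \<SS>" "U \<noteq> S" for U
  proof
    fix x assume x: "x \<in> ?P - U"
    then have "unsplit {x}" "\<not> separates G U {x} S"
      using PV U(1) unsplit_singleton by (auto simp: near_part_def)
    moreover have "\<not> S \<subseteq> U" using cutset_subset_eq[OF S U(1)] U(2) by blast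
    ultimately show "x \<in> side U S"
      using unsplit_separates_iff[OF _ uS U(1), of "{x}"] x unsplit_side(2)[OF _ U(1), of "{x}"]
      by auto
  qed
  have "\<not> splits G U ?P" if "U \<in> \<SS>" for U
  proof (cases "U = S")
    case True
    have "?P - S \<subseteq> C" by (auto simp: near_part_def)
    with C True show ?thesis by (auto simp: splits_def)
  next
    case False
    then have "side U S \<in> comps U"
      using unsplit_side(1)[OF uS that] cutset_subset_eq[OF S that] by blast
    with sub[OF that False] show ?thesis by (auto simp: splits_def)
  qed
  then have uP: "unsplit ?P" using PV by (simp add: unsplit_def)
  have "\<exists>T \<in> \<SS>. separates G T {b} ?P" if b: "b \<in> verts G" "b \<notin> ?P" for b
  proof (cases "b \<in> S \<union> C")
    case False
    have "?P - S \<subseteq> C" by (auto simp: near_part_def)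
    moreover have "D = C" if "D \<in> comps S" "y \<in> D" "y \<in> C" for D y
      using comps_unique[OF that(1) C] that by blast
    \<comment> \<open>\<open>separates\<close> is false for sets inside the cutset, so a vertex of
      \<open>?P\<close> outside \<open>S\<close> is needed.\<close>
    ultimately have "separates G S {b} ?P"
      using False near_part_not_subset[OF S C] unfolding separates_def by fast
    then show ?thesis using S by blast
  next
    case True
    then obtain T where T: "T \<in> \<SS>" "separates G T {b} S"
      using b by (auto simp: near_part_def)
    have "\<not> S \<subseteq> T" using T(2) by (auto simp: separates_def)
    moreover have "S \<subseteq> ?P" using cutset_subset_near_part[OF S] .
    ultimately have "separates G T {b} ?P"
      using T unsplit_separates_iff[OF unsplit_singleton[OF b(1)] uS T(1)]
        unsplit_separates_iff[OF unsplit_singleton[OF b(1)] uP T(1)]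
        unsplit_side_mono[OF uP T(1), of S] by auto
    then show ?thesis using T(1) by blast
  qed
  with uP show ?thesis by (auto simp: parts_def unsplit_def)
qed

text \<open>\<open>B\<close> is unsplit and contains \<open>S\<close>, so none of its vertices is
  separated from \<open>S\<close>; thus \<open>B\<close> lies in the near part, and maximality gives
  equality.\<close>

lemma near_part_unique:
  assumes S: "S \<in> \<SS>" and C: "C \<in> comps S"
    and B: "B \<in> parts G \<SS>" "S \<subseteq> B" "B \<subseteq> S \<union> C"
  shows "B = near_part S C"
proof -
  have "B \<subseteq> near_part S C"
    using B not_separates_subset[OF unsplit_part[OF B(1)]] by (auto simp: near_part_def)
  then show ?thesis
    using unsplit_part_eq[OF B(1)] unsplit_part[OF near_part_in_parts[OF S C]] by metis
qed

text \<open>A part inside \<open>S\<close> would be a proper subset of a near part of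
  \<open>S\<close>, against maximality. So every part has a genuine side at every cutset of the
  family.\<close>

lemma part_not_subset:
  assumes B: "B \<in> parts G \<SS>" and S: "S \<in> \<SS>"
  shows "\<not> B \<subseteq> S"
proof
  assume "B \<subseteq> S"
  obtain c where "c \<in> verts G - S" using cutset_subset[OF S] by blast
  with comps_cover obtain C where C: "C \<in> comps S" by blast
  have "B \<subseteq> near_part S C"
    using \<open>B \<subseteq> S\<close> cutset_subset_near_part[OF S] by blast
  then have "near_part S C = B"
    using unsplit_part_eq[OF B] unsplit_part[OF near_part_in_parts[OF S C]] by blast
  with \<open>B \<subseteq> S\<close> near_part_not_subset[OF S C] show False by simp
qed

lemma part_side:
  assumes "B \<in> parts G \<SS>" "S \<in> \<SS>"
  shows "side S B \<in> comps S" "B \<subseteq> S \<union> side S B"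
  using unsplit_side[OF unsplit_part[OF assms(1)] assms(2) part_not_subset[OF assms]] by auto

text \<open>A tree neighbour of \<open>S\<close> is determined by its side at \<open>S\<close>. This
  yields acyclicity and, with \<open>side_near_part\<close>, the degree of \<open>S\<close>.\<close>

lemma part_eq_near_part:
  assumes "B \<in> parts G \<SS>" "S \<in> \<SS>" "S \<subseteq> B"
  shows "B = near_part S (side S B)"
  by (rule near_part_unique[OF assms(2) part_side(1)[OF assms(1,2)] assms(1,3) part_side(2)[OF assms(1,2)]])

lemma side_near_part:
  assumes S: "S \<in> \<SS>" and C: "C \<in> comps S"
  shows "side S (near_part S C) = C"
proof -
  have P: "near_part S C \<in> parts G \<SS>" using near_part_in_parts[OF S C] .
  obtain x where "x \<in> near_part S C" "x \<notin> S"
    using near_part_not_subset[OF S C] by blast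
  then show ?thesis
    using unsplit_side_eq[OF unsplit_part[OF P] S C, of x] by (auto simp: near_part_def)
qed

section \<open>Cutsets separating two parts\<close>

lemma parts_separates_iff:
  assumes "B \<in> parts G \<SS>" "B' \<in> parts G \<SS>" "S \<in> \<SS>"
  shows "separates G S B B' \<longleftrightarrow> side S B \<noteq> side S B'"
  using unsplit_separates_iff[OF assms(1,2)[THEN unsplit_part] assms(3)]
    part_not_subset[OF assms(1,3)] part_not_subset[OF assms(2,3)] by simp

lemma part_separated_from:
  assumes "B \<in> parts G \<SS>" "b \<in> verts G" "b \<notin> B"
  obtains S where "S \<in> \<SS>" "separates G S {b} B"
  using assms unfolding parts_def by blast

text \<open>By maximality \<open>B\<close> has a vertex outside \<open>B'\<close>; a cutset
  separating that vertex from \<open>B'\<close> has it on the side of \<open>B\<close>.\<close>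

lemma parts_separated:
  assumes B: "B \<in> parts G \<SS>" "B' \<in> parts G \<SS>" "B \<noteq> B'"
  shows "\<exists>S \<in> \<SS>. side S B \<noteq> side S B'"
proof -
  obtain b where b: "b \<in> B" "b \<notin> B'"
    using unsplit_part_eq[OF B(1) _ unsplit_part[OF B(2)]] B(3) by blast
  have bV: "b \<in> verts G" using b(1) B(1) by (auto simp: parts_def)
  then obtain S where S: "S \<in> \<SS>" "separates G S {b} B'"
    using part_separated_from[OF B(2)] b(2) by blast
  then have "b \<notin> S" "side S {b} \<noteq> side S B'"
    using unsplit_separates_iff[OF unsplit_singleton[OF bV] unsplit_part[OF B(2)]] by auto
  moreover from this have "side S {b} = side S B"
    using unsplit_side_mono[OF unsplit_part[OF B(1)] S(1)] b(1) by auto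
  ultimately show ?thesis using S(1) by auto
qed

text \<open>Take a separating \<open>U\<close> with the smallest side of \<open>B\<close>. A vertex
  of \<open>U\<close> outside \<open>B\<close> would be separated from \<open>B\<close> by some
  \<open>W\<close>, whose side of \<open>B\<close> is smaller by \<open>side_descent\<close>; since
  \<open>W\<close> also separates \<open>B\<close> from \<open>B'\<close>, this contradicts the
  choice.\<close>

lemma nearest_separating_cutset:
  assumes B: "B \<in> parts G \<SS>" "B' \<in> parts G \<SS>" "B \<noteq> B'"
  obtains U where "U \<in> \<SS>" "side U B \<noteq> side U B'" "U \<subseteq> B"
proof -
  define \<FF> where "\<FF> = {U \<in> \<SS>. side U B \<noteq> side U B'}"
  have "\<FF> \<noteq> {}" using parts_separated[OF B] unfolding \<FF>_def by blast
  moreover have "finite \<FF>" using finite_family unfolding \<FF>_def by simp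
  ultimately obtain U where U: "U \<in> \<FF>"
      and min: "\<And>W. W \<in> \<FF> \<Longrightarrow> card (side U B) \<le> card (side W B)"
    using ex_min_if_finite[of "(\<lambda>T. card (side T B)) ` \<FF>"] by (auto simp: not_less)
  have US: "U \<in> \<SS>" and ne: "side U B \<noteq> side U B'" using U unfolding \<FF>_def by auto
  have "U \<subseteq> B"
  proof
    fix u assume u: "u \<in> U"
    show "u \<in> B"
    proof (rule ccontr)
      assume "u \<notin> B"
      then obtain W where W: "W \<in> \<SS>" "separates G W {u} B"
        using part_separated_from[OF B(1)] u cutset_subset[OF US] by blast
      have less: "side W B \<subset> side U B"
        using side_descent[OF US W(1) unsplit_part[OF B(1)] part_not_subset[OF B(1) US] u W(2)] .
      \<comment> \<open>If \<open>W\<close> left \<open>B'\<close> on the side of \<open>B\<close>,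
        then \<open>B' - W\<close> would lie in \<open>side W B\<close>, hence in
        \<open>side U B\<close>, and \<open>U\<close> would not separate the two parts.\<close>
      have "side W B \<noteq> side W B'"
      proof
        assume "side W B = side W B'"
        then have "B' - W \<subseteq> side U B"
          using part_side(2)[OF B(2) W(1)] less by blast
        moreover obtain x where "x \<in> B'" "x \<notin> W"
          using part_not_subset[OF B(2) W(1)] by blast
        ultimately have "side U B' = side U B"
          using unsplit_side_eq[OF unsplit_part[OF B(2)] US part_side(1)[OF B(1) US]] by blast
        with ne show False by simp
      qed
      then have "card (side U B) \<le> card (side W B)"
        using min W(1) unfolding \<FF>_def by simp
      with psubset_card_mono[OF finite_side less] show False by simp
    qed
  qed
  with US ne show ?thesis by (rule that)
qed

end

section \<open>The decomposition tree\<close>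

lemma (in wf_digraph) awalk_avoiding_reachable:
  assumes "awalk y q z" "v \<notin> set (awalk_verts y q)"
  shows "y \<rightarrow>\<^sup>*\<^bsub>delete_verts G {v}\<^esub> z"
proof -
  interpret D: wf_digraph "delete_verts G {v}"
    unfolding delete_verts_def by (rule wellformed_induce_subgraph)
  have "set (awalk_verts y q) \<subseteq> verts G - {v}"
    using assms awalk_verts_in_verts by auto
  then have "D.awalk y q z"
    using awalk_induce[OF assms(1)] by (simp add: delete_verts_def)
  then show ?thesis
    by (rule D.reachable_awalkI)
qed

lemma (in wf_digraph) closed_awalk_distinct_Nil:
  assumes "awalk y q y" "distinct (awalk_verts y q)"
  shows "q = []"
proof (cases q)
  case (Cons e es)
  then have "awalk (head G e) es y" "tail G e = y"
    using assms(1) by (auto simp: awalk_Cons_iff)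
  then have "y \<in> set (awalk_verts (head G e) es)"
    using awalk_verts_non_Nil[of "head G e" es] last_in_set[of "awalk_verts (head G e) es"]
    by (auto elim: awalk_ends)
  then show ?thesis
    using assms(2) Cons \<open>tail G e = y\<close> by simp
qed simp

text \<open>Deleting a vertex of a cycle leaves a path between its two cycle neighbours, and having
  three arcs keeps these distinct. \<open>Q\<close> will mark the cutsets; \<open>bip\<close>
  supplies one among any two consecutive vertices.\<close>

lemma (in sym_digraph) cycle_detour:
  assumes p: "cycle p" "3 \<le> length p"
    and bip: "\<And>u v. u \<rightarrow> v \<Longrightarrow> Q u \<or> Q v"
  obtains v y z where "Q v" "v \<rightarrow> y" "v \<rightarrow> z" "y \<noteq> z"
    "y \<rightarrow>\<^sup>*\<^bsub>delete_verts G {v}\<^esub> z"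
proof -
  obtain u where u: "awalk u p u" "distinct (tl (awalk_verts u p))"
    using p(1) by (auto simp: cycle_def)
  obtain e p' where p': "p = e # p'" using p(2) by (cases p) auto
  then have p'2: "2 \<le> length p'" using p(2) by simp
  have e: "e \<in> arcs G" "tail G e = u" "awalk (head G e) p' u"
      "distinct (awalk_verts (head G e) p')"
    using u p' by (auto simp: awalk_Cons_iff)
  have ue: "u \<rightarrow> head G e" using e(1,2) by (auto simp: arcs_ends_conv)
  \<comment> \<open>If \<open>Q\<close> fails at the base point \<open>u\<close>, it holds at the
    second vertex, whose predecessor is \<open>u\<close>. In both cases the remaining walk
    \<open>q\<close> is nonempty with distinct vertices, so its ends differ.\<close>
  show ?thesis
  proof (cases "Q u")
    case True
    obtain q f where q: "p' = q @ [f]" using p'2 by (cases p' rule: rev_cases) auto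
    then have "q \<noteq> []" using p'2 by auto
    have walk: "awalk (head G e) q (tail G f)" and f: "f \<in> arcs G" "head G f = u"
      using e(3) q by (auto simp: awalk_Cons_iff awalk_Nil_iff)
    have "awalk_verts (head G e) p' = awalk_verts (head G e) q @ [u]"
      using awalk_verts_append[OF e(3)[unfolded q]] f q by simp
    then have "distinct (awalk_verts (head G e) q)" "u \<notin> set (awalk_verts (head G e) q)"
      using e(4) by auto
    then have "head G e \<noteq> tail G f" "head G e \<rightarrow>\<^sup>*\<^bsub>delete_verts G {u}\<^esub> tail G f"
      using closed_awalk_distinct_Nil awalk_avoiding_reachable[OF walk] walk \<open>q \<noteq> []\<close> by auto
    moreover have "tail G f \<rightarrow> u" using f by (auto simp: arcs_ends_conv)
    then have "u \<rightarrow> tail G f" by (rule graph_symmetric)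
    ultimately show ?thesis using that[OF True ue] by blast
  next
    case False
    obtain f q where q: "p' = f # q" using p'2 by (cases p') auto
    then have "q \<noteq> []" using p'2 by auto
    have f: "f \<in> arcs G" "tail G f = head G e" and walk: "awalk (head G f) q u"
      using e(3) q by (auto simp: awalk_Cons_iff)
    have "distinct (awalk_verts (head G f) q)" "head G e \<notin> set (awalk_verts (head G f) q)"
      using e(4) f(2) q by auto
    then have "head G f \<noteq> u" "head G f \<rightarrow>\<^sup>*\<^bsub>delete_verts G {head G e}\<^esub> u"
      using closed_awalk_distinct_Nil awalk_avoiding_reachable[OF walk] walk \<open>q \<noteq> []\<close> by auto
    moreover have "head G e \<rightarrow> head G f" using f by (intro dominatesI) (simp_all add: arc_to_ends_def)
    moreover have "Q (head G e)" using bip[OF ue] False by simp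
    ultimately show ?thesis using that graph_symmetric[OF ue] by blast
  qed
qed

section \<open>Connectivity and acyclicity of the tree\<close>

context independent_cutset_family
begin

abbreviation tree where
  "tree \<equiv> with_proj (decomposition_tree G \<SS>)"

lemma verts_tree:
  "pverts (decomposition_tree G \<SS>) = Inl ` \<SS> \<union> Inr ` parts G \<SS>"
  "verts tree = Inl ` \<SS> \<union> Inr ` parts G \<SS>"
  by (simp_all add: decomposition_tree_def)

lemma dominates_tree_iff:
  "u \<rightarrow>\<^bsub>tree\<^esub> v \<longleftrightarrow> (\<exists>S \<in> \<SS>. \<exists>A \<in> parts G \<SS>. S \<subseteq> A \<and>
     (u = Inl S \<and> v = Inr A \<or> u = Inr A \<and> v = Inl S))"
  by (auto simp: decomposition_tree_def)

lemma finite_parts: "finite (parts G \<SS>)"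
  by (rule finite_subset[of _ "Pow (verts G)"]) (auto simp: parts_def)

lemma graph_tree: "graph tree"
proof
  have sub: "parcs (decomposition_tree G \<SS>) \<subseteq> verts tree \<times> verts tree"
    by (auto simp: decomposition_tree_def)
  show fin: "finite (verts tree)"
    using finite_family finite_parts by (simp add: verts_tree)
  then show "finite (arcs tree)"
    using finite_subset[OF sub] by simp
  show "tail tree e \<in> verts tree" "head tree e \<in> verts tree" if "e \<in> arcs tree" for e
    using sub that by auto
  show "tail tree e \<noteq> head tree e" if "e \<in> arcs tree" for e
    using that by (auto simp: decomposition_tree_def)
  show "e1 = e2" if "arc_to_ends tree e1 = arc_to_ends tree e2" for e1 e2
    using that by (simp add: arc_to_ends_def prod_eq_iff)
  show "symmetric tree"
    unfolding symmetric_def sym_def dominates_tree_iff by (intro allI impI, elim bexE) auto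
qed

text \<open>\<open>R\<close> is any set of cutsets not separating \<open>B\<close> from
  \<open>B'\<close>: empty it gives connectivity, with one cutset the separation criterion. Each
  step crosses one separating cutset, and the induction is on their number.\<close>

lemma tree_reachable:
  assumes "B \<in> parts G \<SS>" "B' \<in> parts G \<SS>"
    and "R \<subseteq> Inl ` {S \<in> \<SS>. side S B = side S B'}"
  shows "Inr B \<rightarrow>\<^sup>*\<^bsub>delete_verts tree R\<^esub> Inr B'"
  using assms
proof (induction "card {S \<in> \<SS>. side S B \<noteq> side S B'}" arbitrary: B rule: less_induct)
  case less
  interpret T: graph tree by (rule graph_tree)
  interpret D: graph "delete_verts tree R" by (rule T.graph_delete_verts)
  show ?case
  proof (cases "B = B'")
    case True
    have "Inr B \<in> verts tree - R"
      using less.prems by (auto simp: verts_tree)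
    then show ?thesis using True by auto
  next
    case False
    then obtain U where U: "U \<in> \<SS>" "side U B \<noteq> side U B'" "U \<subseteq> B"
      using nearest_separating_cutset less.prems by blast
    have C: "side U B' \<in> comps U" using part_side(1)[OF less.prems(2) U(1)] .
    \<comment> \<open>\<open>U\<close> lies in both \<open>B\<close> and \<open>B1\<close>, so
      \<open>B\<close>, \<open>U\<close>, \<open>B1\<close> is a path of the tree, and it ends on
      the side of \<open>B'\<close> at \<open>U\<close>.\<close>
    define B1 where "B1 = near_part U (side U B')"
    have B1: "B1 \<in> parts G \<SS>" "U \<subseteq> B1" "side U B1 = side U B'"
      unfolding B1_def using near_part_in_parts cutset_subset_near_part side_near_part U(1) C by auto
    \<comment> \<open>Both parts contain \<open>U\<close>, which has a side at \<open>W\<close>;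
      passing from \<open>B\<close> to \<open>B1\<close> changes only the side at
      \<open>U\<close>.\<close>
    have same: "side W B1 = side W B" if W: "W \<in> \<SS>" "W \<noteq> U" for W
    proof -
      have "\<not> U \<subseteq> W" using cutset_subset_eq[OF U(1) W(1)] W(2) by blast
      then show ?thesis
        using unsplit_side_mono[OF unsplit_part[OF B1(1)] W(1) B1(2)]
          unsplit_side_mono[OF unsplit_part[OF less.prems(1)] W(1) U(3)] by simp
    qed
    have "{S \<in> \<SS>. side S B1 \<noteq> side S B'} \<subset> {S \<in> \<SS>. side S B \<noteq> side S B'}"
    proof (rule psubsetI)
      show "{S \<in> \<SS>. side S B1 \<noteq> side S B'} \<subseteq> {S \<in> \<SS>. side S B \<noteq> side S B'}"
      proof
        fix W assume "W \<in> {S \<in> \<SS>. side S B1 \<noteq> side S B'}"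
        then have "W \<in> \<SS>" "side W B1 \<noteq> side W B'" "W \<noteq> U" using B1(3) by auto
        then show "W \<in> {S \<in> \<SS>. side S B \<noteq> side S B'}" using same[of W] by simp
      qed
      show "{S \<in> \<SS>. side S B1 \<noteq> side S B'} \<noteq> {S \<in> \<SS>. side S B \<noteq> side S B'}"
        using U(1,2) B1(3) by blast
    qed
    then have "card {S \<in> \<SS>. side S B1 \<noteq> side S B'} < card {S \<in> \<SS>. side S B \<noteq> side S B'}"
      by (rule psubset_card_mono[rotated]) (simp add: finite_family)
    moreover have "R \<subseteq> Inl ` {S \<in> \<SS>. side S B1 = side S B'}"
    proof
      fix r assume "r \<in> R"
      then obtain W where W: "r = Inl W" "W \<in> \<SS>" "side W B = side W B'"
        using less.prems(3) by blast
      have "side W B1 = side W B'"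
        using W(2,3) same[of W] B1(3) by (cases "W = U") simp_all
      with W(1,2) show "r \<in> Inl ` {S \<in> \<SS>. side S B1 = side S B'}" by blast
    qed
    ultimately have "Inr B1 \<rightarrow>\<^sup>*\<^bsub>delete_verts tree R\<^esub> Inr B'"
      using less.hyps B1(1) less.prems(2) by blast
    moreover have "Inl U \<notin> R" "Inr B \<notin> R" "Inr B1 \<notin> R"
      using less.prems(3) U(2) by auto
    then have "Inr B \<rightarrow>\<^bsub>delete_verts tree R\<^esub> Inl U"
        "Inl U \<rightarrow>\<^bsub>delete_verts tree R\<^esub> Inr B1"
      using U B1 less.prems(1)
      unfolding dominates_delete_verts_iff dominates_tree_iff verts_tree by blast+
    ultimately show ?thesis
      using D.adj_reachable_trans by blast
  qed
qed

text \<open>\<open>case_sum id id\<close> reads off the set behind a vertex of either kind. An edge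
  joins a cutset \<open>U \<noteq> S\<close> to a part containing it, and \<open>U\<close> is not
  inside \<open>S\<close>, so both have the same side at \<open>S\<close>.\<close>

lemma tree_reachable_side:
  assumes "S \<in> \<SS>" "u \<rightarrow>\<^sup>*\<^bsub>delete_verts tree {Inl S}\<^esub> v"
  shows "side S (case_sum id id u) = side S (case_sum id id v)"
proof -
  interpret T: graph tree by (rule graph_tree)
  interpret D: graph "delete_verts tree {Inl S}" by (rule T.graph_delete_verts)
  show ?thesis
    using assms(2)
  proof (induction rule: D.reachable_induct)
    case (step x y)
    then obtain U A where U: "U \<in> \<SS>" "A \<in> parts G \<SS>" "U \<subseteq> A" "U \<noteq> S"
      and xy: "x = Inl U \<and> y = Inr A \<or> x = Inr A \<and> y = Inl U"
      unfolding dominates_delete_verts_iff dominates_tree_iff by blast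
    have "side S U = side S A"
      using unsplit_side_mono[OF unsplit_part[OF U(2)] assms(1) U(3)]
        cutset_subset_eq[OF U(1) assms(1)] U(4) by blast
    with step.IH xy show ?case by auto
  qed simp
qed

lemma tree_reachable_iff:
  assumes "S \<in> \<SS>" "B \<in> parts G \<SS>" "B' \<in> parts G \<SS>"
  shows "Inr B \<rightarrow>\<^sup>*\<^bsub>delete_verts tree {Inl S}\<^esub> Inr B' \<longleftrightarrow> side S B = side S B'"
proof
  assume "Inr B \<rightarrow>\<^sup>*\<^bsub>delete_verts tree {Inl S}\<^esub> Inr B'"
  from tree_reachable_side[OF assms(1) this] show "side S B = side S B'" by simp
next
  assume "side S B = side S B'"
  then show "Inr B \<rightarrow>\<^sup>*\<^bsub>delete_verts tree {Inl S}\<^esub> Inr B'"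
    using assms by (intro tree_reachable) auto
qed

lemma connected_tree: "Digraph_Component.connected tree"
proof -
  interpret T: graph tree by (rule graph_tree)
  have parts_reachable: "Inr B \<rightarrow>\<^sup>*\<^bsub>tree\<^esub> Inr B'"
    if "B \<in> parts G \<SS>" "B' \<in> parts G \<SS>" for B B'
    using tree_reachable[OF that, of "{}"] T.reachable_induce_subgraphD
    unfolding delete_verts_def by blast
  have to_part: "\<exists>B \<in> parts G \<SS>. u \<rightarrow>\<^sup>*\<^bsub>tree\<^esub> Inr B" if u: "u \<in> verts tree" for u
  proof (cases u)
    case (Inl S)
    then have S: "S \<in> \<SS>" using u by (auto simp: verts_tree)
    obtain c where "c \<in> verts G - S" using cutset_subset[OF S] by blast
    with comps_cover obtain C where C: "C \<in> comps S" by blast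
    have "u \<rightarrow>\<^bsub>tree\<^esub> Inr (near_part S C)"
      using near_part_in_parts[OF S C] cutset_subset_near_part[OF S] S Inl
      unfolding dominates_tree_iff by blast
    then show ?thesis using near_part_in_parts[OF S C] T.reachable_adjI by blast
  next
    case (Inr B)
    then have "B \<in> parts G \<SS>" using u by (auto simp: verts_tree)
    then show ?thesis using T.reachable_refl[OF u] Inr by blast
  qed
  have "u \<rightarrow>\<^sup>*\<^bsub>tree\<^esub> v" if uv: "u \<in> verts tree" "v \<in> verts tree" for u v
  proof -
    obtain B B' where B: "B \<in> parts G \<SS>" "u \<rightarrow>\<^sup>*\<^bsub>tree\<^esub> Inr B"
      and B': "B' \<in> parts G \<SS>" "v \<rightarrow>\<^sup>*\<^bsub>tree\<^esub> Inr B'"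
      using to_part uv by blast
    note B(2)
    also note parts_reachable[OF B(1) B'(1)]
    also note T.symmetric_reachable'[OF B'(2)]
    finally show ?thesis .
  qed
  moreover have "verts tree \<noteq> {}"
  proof (cases "\<SS> = {}")
    case True
    \<comment> \<open>Without cutsets the whole vertex set is a part, so the tree is not
      empty.\<close>
    then have "verts G \<in> parts G \<SS>" by (simp add: parts_def)
    then show ?thesis by (auto simp: verts_tree)
  next
    case False
    then show ?thesis by (auto simp: verts_tree)
  qed
  ultimately show ?thesis unfolding T.connected_iff_reachable by blast
qed

text \<open>On a cycle some cutset \<open>S\<close> would have two different neighbours joined
  outside \<open>S\<close>; they have the same side at \<open>S\<close>, which determines a
  neighbour of \<open>S\<close>.\<close>

lemma undirected_tree_tree: "undirected_tree tree"
proof -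
  interpret T: graph tree by (rule graph_tree)
  have "\<not> T.cycle p" if p3: "3 \<le> length p" for p
  proof
    assume "T.cycle p"
    have bip: "isl u \<or> isl v" if "u \<rightarrow>\<^bsub>tree\<^esub> v" for u v
      using that unfolding dominates_tree_iff by auto
    obtain v y z where v: "isl v" "v \<rightarrow>\<^bsub>tree\<^esub> y"
        "v \<rightarrow>\<^bsub>tree\<^esub> z" "y \<noteq> z"
        "y \<rightarrow>\<^sup>*\<^bsub>delete_verts tree {v}\<^esub> z"
      by (rule T.cycle_detour[OF \<open>T.cycle p\<close> p3 bip])
    obtain S where S: "v = Inl S" "S \<in> \<SS>"
      using v(1,2) unfolding dominates_tree_iff by auto
    obtain A where A: "A \<in> parts G \<SS>" "S \<subseteq> A" "y = Inr A"
      using v(2) S(1) unfolding dominates_tree_iff by auto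
    obtain A' where A': "A' \<in> parts G \<SS>" "S \<subseteq> A'" "z = Inr A'"
      using v(3) S(1) unfolding dominates_tree_iff by auto
    have "side S A = side S A'"
      using tree_reachable_iff[OF S(2) A(1) A'(1)] v(5) S(1) A(3) A'(3) by simp
    then have "A = A'"
      using part_eq_near_part[OF A(1) S(2) A(2)] part_eq_near_part[OF A'(1) S(2) A'(2)] by simp
    with v(4) A(3) A'(3) show False by simp
  qed
  then show ?thesis
    unfolding undirected_tree_def using graph_tree connected_tree by blast
qed

section \<open>Degrees, leaves and separation in the tree\<close>

lemma card_comps_eq_card_parts:
  assumes S: "S \<in> \<SS>"
  shows "card (parts G {S}) = card (comps S)"
proof -
  have "inj_on (\<lambda>C. S \<union> C) (comps S)"
  proof (rule inj_onI)
    fix C D assume "C \<in> comps S" "D \<in> comps S" "S \<union> C = S \<union> D"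
    with comps_subset[of C S] comps_subset[of D S] show "C = D" by blast
  qed
  then show ?thesis
    by (simp add: parts_singleton[OF cutset[OF S]] card_image)
qed

text \<open>\<open>near_part S\<close> is a bijection from the components of \<open>G - S\<close> to
  the neighbours of \<open>S\<close>; taking the side at \<open>S\<close> inverts it.\<close>

lemma out_degree_tree:
  assumes S: "S \<in> \<SS>"
  shows "out_degree tree (Inl S) = card (comps S)"
proof -
  let ?arc = "\<lambda>C. (Inl S, Inr (near_part S C)) :: ('a set + 'a set) \<times> ('a set + 'a set)"
  have "out_arcs tree (Inl S) = ?arc ` comps S"
  proof (intro set_eqI iffI)
    fix e assume "e \<in> out_arcs tree (Inl S)"
    then obtain A where A: "A \<in> parts G \<SS>" "S \<subseteq> A" "e = (Inl S, Inr A)"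
      by (auto simp: decomposition_tree_def)
    then show "e \<in> ?arc ` comps S"
      using part_eq_near_part[OF A(1) S A(2)] part_side(1)[OF A(1) S] by blast
  next
    fix e assume "e \<in> ?arc ` comps S"
    then obtain C where C: "C \<in> comps S" "e = (Inl S, Inr (near_part S C))" by blast
    then have "(Inl S, Inr (near_part S C)) \<in> parcs (decomposition_tree G \<SS>)"
      using near_part_in_parts[OF S C(1)] cutset_subset_near_part[OF S] S
      by (auto simp: decomposition_tree_def)
    with C(2) show "e \<in> out_arcs tree (Inl S)" by simp
  qed
  moreover have "inj_on ?arc (comps S)"
    by (rule inj_on_inverseI[where g = "\<lambda>e. side S (case_sum id id (snd e))"])
      (simp add: side_near_part[OF S])
  ultimately show ?thesis by (simp add: out_degree_def card_image)
qed

lemma adjacent_part_in_part: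
  assumes S: "S \<in> \<SS>" and A: "A \<in> parts G {S}"
  shows "\<exists>!B. B \<in> parts G \<SS> \<and> B \<subseteq> A \<and> Inl S \<rightarrow>\<^bsub>tree\<^esub> Inr B"
proof -
  obtain C where C: "C \<in> comps S" "A = S \<union> C"
    using A unfolding parts_singleton[OF cutset[OF S]] by blast
  have adj: "Inl S \<rightarrow>\<^bsub>tree\<^esub> Inr B \<longleftrightarrow> B \<in> parts G \<SS> \<and> S \<subseteq> B" for B
    using S unfolding dominates_tree_iff by blast
  show ?thesis
  proof (rule ex1I[of _ "near_part S C"])
    show "near_part S C \<in> parts G \<SS> \<and> near_part S C \<subseteq> A \<and>
        Inl S \<rightarrow>\<^bsub>tree\<^esub> Inr (near_part S C)"
      unfolding adj using near_part_in_parts[OF S C(1)] cutset_subset_near_part[OF S] C(2)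
      by (auto simp: near_part_def)
  next
    fix B assume "B \<in> parts G \<SS> \<and> B \<subseteq> A \<and> Inl S \<rightarrow>\<^bsub>tree\<^esub> Inr B"
    then show "B = near_part S C"
      unfolding adj using near_part_unique[OF S C(1)] C(2) by blast
  qed
qed

text \<open>Deleting a cutset leaves at least two components, so its degree in the tree is at least
  two.\<close>

lemma leaf_tree:
  assumes "leaf tree x"
  shows "\<exists>A \<in> parts G \<SS>. x = Inr A"
proof (rule ccontr)
  assume "\<not> ?thesis"
  then obtain S where S: "S \<in> \<SS>" "x = Inl S"
    using assms unfolding leaf_def verts_tree by blast
  then have "card (comps S) = 1"
    using assms out_degree_tree[OF S(1)] by (simp add: leaf_def)
  then obtain C where C: "comps S = {C}" by (rule card_1_singletonE)
  then have "C \<in> comps S" by simp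
  then obtain D where "D \<in> comps S" "D \<noteq> C"
    by (rule comps_two[OF cutset[OF S(1)]])
  with C show False by simp
qed

text \<open>The noncontainment clauses of \<open>separates\<close> hold automatically, in the tree
  because \<open>Inl\<close> and \<open>Inr\<close> differ and in \<open>G\<close> because no part
  lies inside a cutset of the family; what remains compares sides.\<close>

lemma tree_separates_iff:
  assumes "S \<in> \<SS>" "B \<in> parts G \<SS>" "B' \<in> parts G \<SS>"
  shows "separates tree {Inl S} {Inr B} {Inr B'} \<longleftrightarrow> separates G S B B'"
proof -
  interpret T: graph tree by (rule graph_tree)
  have "separates tree {Inl S} {Inr B} {Inr B'} \<longleftrightarrow>
      \<not> (\<exists>C \<in> components (delete_verts tree {Inl S}). Inr B \<in> C \<and> Inr B' \<in> C)"
    using separatesD[of tree "{Inl S}" "{Inr B}" "{Inr B'}"]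
    by (intro iffI separatesI) blast+
  then show ?thesis
    by (simp only: T.comps_same_iff tree_reachable_iff[OF assms] parts_separates_iff[OF assms(2,3,1)])
qed

end

theorem theorem1:
  fixes G :: "('a, 'b) pre_digraph" and k :: nat and \<SS> :: "'a set set"
    and T :: "('a set + 'a set, ('a set + 'a set) \<times> ('a set + 'a set)) pre_digraph"
  defines "T \<equiv> with_proj (decomposition_tree G \<SS>)"
  assumes "graph G"
    and "k_connected G k"
    and "\<SS> \<subseteq> k_cutsets G k"
    and "pairwise (independent_cutsets G) \<SS>"
  shows "undirected_tree T
    \<and> ((\<forall>S \<in> \<SS>. out_degree T (Inl S) = card (parts G {S})
          \<and> (\<forall>A \<in> parts G {S}. \<exists>!B. B \<in> parts G \<SS> \<and> B \<subseteq> A \<and> Inl S \<rightarrow>\<^bsub>T\<^esub> Inr B))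
       \<and> (\<forall>x. leaf T x \<longrightarrow> (\<exists>A \<in> parts G \<SS>. x = Inr A)))
    \<and> (\<forall>S \<in> \<SS>. \<forall>B \<in> parts G \<SS>. \<forall>B' \<in> parts G \<SS>.
         separates G S B B' \<longleftrightarrow> separates T {Inl S} {Inr B} {Inr B'})"
proof -
  interpret independent_cutset_family G k \<SS>
    using assms(2-5) 
    by (intro independent_cutset_family.intro independent_cutset_family_axioms.intro)
  show ?thesis
    unfolding T_def
    by (intro conjI ballI allI impI undirected_tree_tree adjacent_part_in_part leaf_tree
        tree_separates_iff[symmetric])
      (simp_all only: out_degree_tree card_comps_eq_card_parts)
qed

end
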